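(* Let $Q$ be a finite alphabet with $|Q|\ge 2$, let $Z$ be a countable set, and let $f:Q^Z\to Q^Z$ be a network. Then: (i) $f$ satisfies (C1) $\iff$ $f$ satisfies (C1a) $\iff$ $f$ satisfies (C1b); (ii) $f$ satisfies (C2) $\iff$ $f$ satisfies (C2a) $\iff$ $f$ satisfies (C2b); (iii) $f$ satisfies (C3) $\iff$ $f$ satisfies (C3a) $\iff$ $f$ satisfies (C3b); (iv) $f$ satisfies (C1) $\iff$ $f$ satisfies (C2). Moreover, there exist a finite alphabet $Q$ with $|Q|\ge2$, a countable set $Z$ and a network $f:Q^Z\to Q^Z$ which satisfies (C1) but does not satisfy (C3).
   Context: A network is any map $f:Q^Z\to Q^Z$, with coordinate functions $f_i:Q^Z\to Q$ ($i\in Z$). For $x\in Q^Z$ and $s\subseteq Z$ write $x_s=(x_i)_{i\in s}$, $f_s=(f_i)_{i\in s}$, and $(x_s,y_{Z\setminus s})$ for the configuration equal to $x$ on $s$ and to $y$ on $Z\setminus s$. For $s\subseteq Z$, the update of $s$ is $f^{(s)}:Q^Z\to Q^Z$, $f^{(s)}(x)=(f_s(x),x_{Z\setminus s})$; for a finite sequence $s_1,\dots,s_k$ of subsets, $f^{(s_1,\dots,s_k)}=f^{(s_k)}\circ\cdots\circ f^{(s_1)}$; for $i\in Z$, $f^{(i)}=f^{(\{i\})}$. Commutativity properties: (C1) $f^{(i,j)}=f^{(j,i)}$ for all $i,j\in Z$; (C2) $f^{(b,c)}=f^{(c,b)}$ for all finite $b,c\subseteq Z$; (C3) $f^{(s,t)}=f^{(t,s)}$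 for all $s,t\subseteq Z$. An enumeration of $Z$ is a sequence $Y=(y_\tau:\tau\in\mathbb{N})$ ($\mathbb N=\{1,2,\dots\}$) of pairwise disjoint subsets of $Z$ (possibly empty) with $\bigcup_\tau y_\tau=Z$. It is sequential if each $y_\tau$ is a singleton or empty, and finite-block if each $y_\tau$ is finite. Write $Y_t=(y_1,\dots,y_t)$, and define $f^Y:Q^Z\to Q^Z$ by $f^Y_{y_\tau}:=f^{(y_1,\dots,y_\tau)}_{y_\tau}$ for all $\tau\in\mathbb{N}$. (C1a) $f^I=f^J$ for any two sequential enumerations $I,J$ of $Z$; (C2a) $f^B=f^C$ for any two finite-block enumerations $B,C$ of $Z$; (C3a) $f^S=f^T$ for any two enumerations $S,T$ of $Z$. (C1b) $f=f^I$ for every sequential enumeration $I$ of $Z$; (C2b) $f=f^B$ for every finite-block enumeration $B$ of $Z$; (C3b) $f=f^S$ for every enumeration $S$ of $Z$. *)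

theory Defs
  imports "HOL-Library.FuncSet" "HOL-Library.Countable_Set" "HOL-Library.Disjoint_Sets"
begin

text \<open>Alphabet and index set are carrier sets; \<open>Q\<^sup>Z\<close> is \<open>Z \<rightarrow>\<^sub>E Q\<close>. Networks are total
  HOL functions whose values outside \<open>Z \<rightarrow>\<^sub>E Q\<close> are irrelevant, so equality of maps
  on \<open>Q\<^sup>Z\<close> is always pointwise equality on \<open>Z \<rightarrow>\<^sub>E Q\<close>.\<close>

definition is_network :: "'q set \<Rightarrow> 'z set \<Rightarrow> (('z \<Rightarrow> 'q) \<Rightarrow> ('z \<Rightarrow> 'q)) \<Rightarrow> bool" where
  "is_network Q Z f \<longleftrightarrow> f \<in> (Z \<rightarrow>\<^sub>E Q) \<rightarrow> (Z \<rightarrow>\<^sub>E Q)"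

definition maps_eq :: "'q set \<Rightarrow> 'z set \<Rightarrow> (('z \<Rightarrow> 'q) \<Rightarrow> ('z \<Rightarrow> 'q)) \<Rightarrow> (('z \<Rightarrow> 'q) \<Rightarrow> ('z \<Rightarrow> 'q)) \<Rightarrow> bool" where
  "maps_eq Q Z g h \<longleftrightarrow> (\<forall>x \<in> Z \<rightarrow>\<^sub>E Q. g x = h x)"

definition update :: "(('z \<Rightarrow> 'q) \<Rightarrow> ('z \<Rightarrow> 'q)) \<Rightarrow> 'z set \<Rightarrow> ('z \<Rightarrow> 'q) \<Rightarrow> ('z \<Rightarrow> 'q)" where
  "update f s x = (\<lambda>i. if i \<in> s then f x i else x i)"

text \<open>The first set of the list is updated first.\<close>

definition updates :: "(('z \<Rightarrow> 'q) \<Rightarrow> ('z \<Rightarrow> 'q)) \<Rightarrow> 'z set list \<Rightarrow> ('z \<Rightarrow> 'q) \<Rightarrow> ('z \<Rightarrow> 'q)" where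
  "updates f ss = fold (update f) ss"

text \<open>Enumerations are indexed from \<open>0\<close>: \<open>Y \<tau>\<close> is the set usually written \<open>y\<^bsub>\<tau>+1\<^esub>\<close>.\<close>

definition enumeration :: "'z set \<Rightarrow> (nat \<Rightarrow> 'z set) \<Rightarrow> bool" where
  "enumeration Z Y \<longleftrightarrow> disjoint_family Y \<and> (\<Union>\<tau>. Y \<tau>) = Z"

definition sequential_enumeration :: "'z set \<Rightarrow> (nat \<Rightarrow> 'z set) \<Rightarrow> bool" where
  "sequential_enumeration Z Y \<longleftrightarrow> enumeration Z Y \<and> (\<forall>\<tau>. Y \<tau> = {} \<or> (\<exists>i. Y \<tau> = {i}))"

definition finite_block_enumeration :: "'z set \<Rightarrow> (nat \<Rightarrow> 'z set) \<Rightarrow> bool" where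
  "finite_block_enumeration Z Y \<longleftrightarrow> enumeration Z Y \<and> (\<forall>\<tau>. finite (Y \<tau>))"

text \<open>The network \<open>f\<^sup>Y\<close>. The index of the block containing \<open>i\<close> is unique when \<open>Y\<close> is an
  enumeration; \<open>enum_network_block\<close> below is the blockwise defining equation.\<close>

definition enum_network ::
    "'z set \<Rightarrow> (('z \<Rightarrow> 'q) \<Rightarrow> ('z \<Rightarrow> 'q)) \<Rightarrow> (nat \<Rightarrow> 'z set) \<Rightarrow> ('z \<Rightarrow> 'q) \<Rightarrow> ('z \<Rightarrow> 'q)" where
  "enum_network Z f Y x = (\<lambda>i\<in>Z. updates f (map Y [0..<Suc (THE \<tau>. i \<in> Y \<tau>)]) x i)"

lemma update_in_configs:
  assumes "is_network Q Z f" "s \<subseteq> Z" "x \<in> Z \<rightarrow>\<^sub>E Q"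
  shows "update f s x \<in> Z \<rightarrow>\<^sub>E Q"
proof -
  have "f x \<in> Z \<rightarrow>\<^sub>E Q"
    using assms by (auto simp: is_network_def)
  with assms(2,3) show ?thesis
    by (auto simp: update_def PiE_iff extensional_def)
qed

lemma enum_network_block:
  assumes "enumeration Z Y" "i \<in> Y \<tau>"
  shows "enum_network Z f Y x i = updates f (map Y [0..<Suc \<tau>]) x i"
proof -
  have "(THE \<sigma>. i \<in> Y \<sigma>) = \<tau>"
    using assms by (intro the_equality) (auto simp: enumeration_def disjoint_family_on_def)
  moreover have "i \<in> Z"
    using assms by (auto simp: enumeration_def)
  ultimately show ?thesis
    by (simp add: enum_network_def)
qed

definition C1 :: "'q set \<Rightarrow> 'z set \<Rightarrow> (('z \<Rightarrow> 'q) \<Rightarrow> ('z \<Rightarrow> 'q)) \<Rightarrow> bool" where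
  "C1 Q Z f \<longleftrightarrow> (\<forall>i\<in>Z. \<forall>j\<in>Z. maps_eq Q Z (updates f [{i}, {j}]) (updates f [{j}, {i}]))"

definition C2 :: "'q set \<Rightarrow> 'z set \<Rightarrow> (('z \<Rightarrow> 'q) \<Rightarrow> ('z \<Rightarrow> 'q)) \<Rightarrow> bool" where
  "C2 Q Z f \<longleftrightarrow> (\<forall>b c. b \<subseteq> Z \<and> finite b \<and> c \<subseteq> Z \<and> finite c
     \<longrightarrow> maps_eq Q Z (updates f [b, c]) (updates f [c, b]))"

definition C3 :: "'q set \<Rightarrow> 'z set \<Rightarrow> (('z \<Rightarrow> 'q) \<Rightarrow> ('z \<Rightarrow> 'q)) \<Rightarrow> bool" where
  "C3 Q Z f \<longleftrightarrow> (\<forall>s t. s \<subseteq> Z \<and> t \<subseteq> Z \<longrightarrow> maps_eq Q Z (updates f [s, t]) (updates f [t, s]))"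

definition C1a :: "'q set \<Rightarrow> 'z set \<Rightarrow> (('z \<Rightarrow> 'q) \<Rightarrow> ('z \<Rightarrow> 'q)) \<Rightarrow> bool" where
  "C1a Q Z f \<longleftrightarrow> (\<forall>I J. sequential_enumeration Z I \<and> sequential_enumeration Z J
     \<longrightarrow> maps_eq Q Z (enum_network Z f I) (enum_network Z f J))"

definition C2a :: "'q set \<Rightarrow> 'z set \<Rightarrow> (('z \<Rightarrow> 'q) \<Rightarrow> ('z \<Rightarrow> 'q)) \<Rightarrow> bool" where
  "C2a Q Z f \<longleftrightarrow> (\<forall>B C. finite_block_enumeration Z B \<and> finite_block_enumeration Z C
     \<longrightarrow> maps_eq Q Z (enum_network Z f B) (enum_network Z f C))"

definition C3a :: "'q set \<Rightarrow> 'z set \<Rightarrow> (('z \<Rightarrow> 'q) \<Rightarrow> ('z \<Rightarrow> 'q)) \<Rightarrow> bool" where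
  "C3a Q Z f \<longleftrightarrow> (\<forall>S T. enumeration Z S \<and> enumeration Z T
     \<longrightarrow> maps_eq Q Z (enum_network Z f S) (enum_network Z f T))"

definition C1b :: "'q set \<Rightarrow> 'z set \<Rightarrow> (('z \<Rightarrow> 'q) \<Rightarrow> ('z \<Rightarrow> 'q)) \<Rightarrow> bool" where
  "C1b Q Z f \<longleftrightarrow> (\<forall>I. sequential_enumeration Z I \<longrightarrow> maps_eq Q Z f (enum_network Z f I))"

definition C2b :: "'q set \<Rightarrow> 'z set \<Rightarrow> (('z \<Rightarrow> 'q) \<Rightarrow> ('z \<Rightarrow> 'q)) \<Rightarrow> bool" where
  "C2b Q Z f \<longleftrightarrow> (\<forall>B. finite_block_enumeration Z B \<longrightarrow> maps_eq Q Z f (enum_network Z f B))"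

definition C3b :: "'q set \<Rightarrow> 'z set \<Rightarrow> (('z \<Rightarrow> 'q) \<Rightarrow> ('z \<Rightarrow> 'q)) \<Rightarrow> bool" where
  "C3b Q Z f \<longleftrightarrow> (\<forall>S. enumeration Z S \<longrightarrow> maps_eq Q Z f (enum_network Z f S))"

end

theory Submission imports Defs begin

text \<open>For distinct \<open>i, j\<close>, comparing the \<open>i\<close>-th coordinates of \<open>f\<^sup>(\<^sup>i\<^sup>,\<^sup>j\<^sup>)\<close> and \<open>f\<^sup>(\<^sup>j\<^sup>,\<^sup>i\<^sup>)\<close> shows that they commute
  iff \<open>f\<^sub>i\<close> does not notice an update of \<open>j\<close> and vice versa. More generally, each of the properties
  turns out to be equivalent to: \<open>f\<^sub>i\<close> does not notice an update of \<open>U\<close>, whenever \<open>i \<notin> U\<close> and \<open>U\<close> is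
  an admissible block. For finite blocks this follows from the case of
  singletons by adding one element of \<open>U\<close> at a time. Under (C3) infinite \<open>U\<close> are admissible, and a
  network all of whose coordinates depend only on the tail of the configuration tells the two apart.\<close>

section \<open>Insensitivity and commuting updates\<close>

definition insensitive ::
    "'q set \<Rightarrow> 'z set \<Rightarrow> 'z set set \<Rightarrow> (('z \<Rightarrow> 'q) \<Rightarrow> ('z \<Rightarrow> 'q)) \<Rightarrow> bool" where
  "insensitive Q Z F f \<longleftrightarrow>
     (\<forall>U\<in>F. \<forall>i\<in>Z - U. \<forall>x\<in>Z \<rightarrow>\<^sub>E Q. f (update f U x) i = f x i)"

lemma insensitiveD:
  "insensitive Q Z F f \<Longrightarrow> U \<in> F \<Longrightarrow> i \<in> Z \<Longrightarrow> i \<notin> U \<Longrightarrow> x \<in> Z \<rightarrow>\<^sub>E Q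
     \<Longrightarrow> f (update f U x) i = f x i"
  by (auto simp: insensitive_def)

lemma updates_Nil [simp]: "updates f [] x = x"
  and updates_Cons [simp]: "updates f (s # ss) x = updates f ss (update f s x)"
  and updates_snoc: "updates f (ss @ [s]) x = update f s (updates f ss x)"
  by (simp_all add: updates_def)

text \<open>With a singleton as the second block, the hypothesis is available both from (C1), where
  \<open>s\<close> is a singleton too, and from (C3).\<close>

lemma commute_imp_insensitive:
  assumes "\<And>s i. s \<in> F \<Longrightarrow> i \<in> Z \<Longrightarrow> i \<notin> s \<Longrightarrow>
      maps_eq Q Z (updates f [s, {i}]) (updates f [{i}, s])"
  shows "insensitive Q Z F f"
  unfolding insensitive_def
proof (intro ballI)
  fix U i x
  assume U: "U \<in> F" and i: "i \<in> Z - U" and x: "x \<in> Z \<rightarrow>\<^sub>E Q"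
  then have "updates f [U, {i}] x i = updates f [{i}, U] x i"
    using assms[of U i] by (simp add: maps_eq_def del: updates_Cons)
  then show "f (update f U x) i = f x i"
    using i by (simp add: update_def)
qed

text \<open>A coordinate in exactly one of the two sets is settled by insensitivity to the other
  set. A coordinate in both is updated twice; by \<open>one\<close>, its second value is the one
  that follows an update of this coordinate alone, whichever set came first. Closure under subsets
  puts \<open>{i}\<close> and \<open>U - {i}\<close> into \<open>F\<close>.\<close>

lemma insensitive_imp_commute:
  assumes ins: "insensitive Q Z F f" and net: "is_network Q Z f"
    and sub: "F \<subseteq> Pow Z" and down: "\<And>U V. U \<in> F \<Longrightarrow> V \<subseteq> U \<Longrightarrow> V \<in> F"
    and s: "s \<in> F" and t: "t \<in> F"
  shows "maps_eq Q Z (updates f [s, t]) (updates f [t, s])"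
  unfolding maps_eq_def
proof (intro ballI ext)
  fix x i
  assume x: "x \<in> Z \<rightarrow>\<^sub>E Q"
  have one: "f (update f U x) i = f (update f {i} x) i" if U: "U \<in> F" "i \<in> U" for U
  proof -
    have iZ: "i \<in> Z" using U sub by auto
    have "{i} \<in> F" "U - {i} \<in> F"
      using U down by blast+
    \<comment> \<open>The update of \<open>i\<close> may be split off and done first, since the
      other coordinates of \<open>U\<close> do not notice it.\<close>
    have "update f U x = update f (U - {i}) (update f {i} x)"
    proof
      fix j
      show "update f U x j = update f (U - {i}) (update f {i} x) j"
        using insensitiveD[OF ins \<open>{i} \<in> F\<close> _ _ x, of j] U subsetD[OF sub U(1)]
        by (auto simp: update_def[of f U] update_def[of f "U - {i}"] update_def[of f "{i}" x])
    qed
    then show ?thesis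
      using insensitiveD[OF ins \<open>U - {i} \<in> F\<close> iZ _ update_in_configs[OF net _ x]] iZ by simp
  qed
  have "f (update f s x) i = f (update f t x) i" if "i \<in> s" "i \<in> t"
    using one[OF s] one[OF t] that by simp
  moreover have "f (update f s x) i = f x i" if "i \<in> t" "i \<notin> s"
    using insensitiveD[OF ins s _ _ x, of i] that t sub by auto
  moreover have "f (update f t x) i = f x i" if "i \<in> s" "i \<notin> t"
    using insensitiveD[OF ins t _ _ x, of i] that s sub by auto
  ultimately show "updates f [s, t] x i = updates f [t, s] x i"
    by (simp add: update_def[of f t "update f s x"] update_def[of f s "update f t x"])
       (simp add: update_def)
qed

lemma insensitive_finite:
  assumes net: "is_network Q Z f" and ins: "insensitive Q Z ((\<lambda>j. {j}) ` Z) f"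
  shows "insensitive Q Z {U. U \<subseteq> Z \<and> finite U} f"
proof -
  have "\<forall>i\<in>Z - U. \<forall>x\<in>Z \<rightarrow>\<^sub>E Q. f (update f U x) i = f x i" if "finite U" "U \<subseteq> Z" for U
    using that
  proof (induction U rule: finite_induct)
    case empty
    then show ?case by (simp add: update_def)
  next
    case (insert j U)
    then have IH: "f (update f U x) i = f x i" if "i \<in> Z" "i \<notin> U" "x \<in> Z \<rightarrow>\<^sub>E Q" for i x
      using that by auto
    show ?case
    proof (intro ballI)
      fix i x
      assume i: "i \<in> Z - insert j U" and x: "x \<in> Z \<rightarrow>\<^sub>E Q"
      \<comment> \<open>By the induction hypothesis at \<open>j\<close>, updating \<open>U\<close>
        first leaves the value written at \<open>j\<close> unchanged.\<close>
      have "update f (insert j U) x = update f {j} (update f U x)"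
        using insert.prems insert.hyps IH[of j x] x
        by (auto simp: update_def[of f "{j}"] update_def[of f "insert j U"] update_def[of f U x])
      moreover have "f (update f {j} (update f U x)) i = f (update f U x) i"
        using i insert.prems update_in_configs[OF net _ x, of U]
        by (intro insensitiveD[OF ins]) auto
      ultimately show "f (update f (insert j U) x) i = f x i"
        using IH[of i x] i x by simp
    qed
  qed
  then show ?thesis by (auto simp: insensitive_def)
qed

section \<open>Updating along an enumeration\<close>

lemma insensitive_updates:
  assumes ins: "insensitive Q Z F f" and sub: "F \<subseteq> Pow Z"
    and Un: "{} \<in> F" "\<And>U V. U \<in> F \<Longrightarrow> V \<in> F \<Longrightarrow> U \<union> V \<in> F"
    and Y: "disjoint_family Y" "\<And>\<tau>. Y \<tau> \<in> F" and x: "x \<in> Z \<rightarrow>\<^sub>E Q"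
  shows "updates f (map Y [0..<n]) x = update f (\<Union>\<tau><n. Y \<tau>) x \<and> (\<Union>\<tau><n. Y \<tau>) \<in> F"
\<comment> \<open>Each new block is disjoint from the earlier ones and does not notice their
  updates, so all updates collapse to a single one of the union. Membership of the union in
  \<open>F\<close> is carried along because insensitivity is applied to that union.\<close>
proof (induction n)
  case 0
  then show ?case using Un by (simp add: update_def)
next
  case (Suc n)
  let ?U = "\<Union>\<tau><n. Y \<tau>"
  have "updates f (map Y [0..<Suc n]) x = update f (Y n) (update f ?U x)"
    using Suc by (simp add: updates_snoc)
  also have "\<dots> = update f (?U \<union> Y n) x"
  proof
    fix i
    have "f (update f ?U x) i = f x i" if "i \<in> Y n"
    proof (rule insensitiveD[OF ins])
      show "i \<notin> ?U" using disjoint_family_onD[OF Y(1), of n] that by fastforce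
    qed (use that x Suc Y(2)[of n] sub in auto)
    then show "update f (Y n) (update f ?U x) i = update f (?U \<union> Y n) x i"
      by (simp add: update_def[of f "Y n"] update_def[of f "?U \<union> Y n"]) (simp add: update_def)
  qed
  finally have "updates f (map Y [0..<Suc n]) x = update f (?U \<union> Y n) x" .
  moreover have "?U \<union> Y n = (\<Union>\<tau><Suc n. Y \<tau>)" by (auto simp: less_Suc_eq)
  moreover have "?U \<union> Y n \<in> F" using Suc Un(2) Y(2) by blast
  ultimately show ?case by simp
qed

text \<open>The blocks before the one containing \<open>i\<close> amount to one update of a set that
  avoids \<open>i\<close>, which \<open>f\<close> at \<open>i\<close> does not notice.\<close>

lemma insensitive_imp_enum_network:
  assumes ins: "insensitive Q Z F f" and sub: "F \<subseteq> Pow Z" and net: "is_network Q Z f"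
    and Un: "{} \<in> F" "\<And>U V. U \<in> F \<Longrightarrow> V \<in> F \<Longrightarrow> U \<union> V \<in> F"
    and Y: "enumeration Z Y" "\<And>\<tau>. Y \<tau> \<in> F"
  shows "maps_eq Q Z f (enum_network Z f Y)"
  unfolding maps_eq_def
proof (intro ballI ext)
  fix x i
  assume x: "x \<in> Z \<rightarrow>\<^sub>E Q"
  show "f x i = enum_network Z f Y x i"
  proof (cases "i \<in> Z")
    case True
    then obtain \<tau> where \<tau>: "i \<in> Y \<tau>" using Y(1) by (auto simp: enumeration_def)
    have disj: "disjoint_family Y" using Y(1) by (simp add: enumeration_def)
    let ?U = "\<Union>\<sigma><\<tau>. Y \<sigma>"
    have U: "updates f (map Y [0..<\<tau>]) x = update f ?U x" "?U \<in> F"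
      using insensitive_updates[OF ins sub Un disj Y(2) x] by auto
    have "enum_network Z f Y x i = updates f (map Y [0..<Suc \<tau>]) x i"
      by (rule enum_network_block[OF Y(1) \<tau>])
    also have "\<dots> = f (update f ?U x) i"
      using \<tau> U(1) by (simp add: updates_snoc update_def[of f "Y \<tau>"])
    also have "\<dots> = f x i"
    proof (rule insensitiveD[OF ins U(2) True _ x])
      show "i \<notin> ?U" using disjoint_family_onD[OF disj, of \<tau>] \<tau> by fastforce
    qed
    finally show ?thesis by simp
  next
    case False
    \<comment> \<open>Outside \<open>Z\<close> both sides take the default value
      \<open>undefined\<close>.\<close>
    have "f x \<in> Z \<rightarrow>\<^sub>E Q" using net x by (auto simp: is_network_def)
    then have "f x i = undefined" using False by (rule PiE_arb)
    then show ?thesis using False by (simp add: enum_network_def)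
  qed
qed

section \<open>Enumerations with prescribed first blocks\<close>

lemma enumeration_case_nat:
  assumes "enumeration (Z - s) Y" "s \<subseteq> Z"
  shows "enumeration Z (case_nat s Y)"
proof -
  have "Y n \<inter> s = {}" for n
    using assms by (auto simp: enumeration_def)
  then have "disjoint_family (case_nat s Y)"
    using assms(1) by (auto simp: enumeration_def disjoint_family_on_def split: nat.splits)
  moreover have "(\<Union>\<tau>. case_nat s Y \<tau>) = s \<union> (\<Union>\<tau>. Y \<tau>)"
    by (auto split: nat.splits intro: exI[of _ 0] exI[of _ "Suc _"])
  ultimately show ?thesis
    using assms by (auto simp: enumeration_def)
qed

lemma sequential_enumeration_case_nat:
  assumes "sequential_enumeration (Z - {i}) Y" "i \<in> Z"
  shows "sequential_enumeration Z (case_nat {i} Y)"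
  using assms enumeration_case_nat[of Z "{i}" Y]
  by (auto simp: sequential_enumeration_def split: nat.splits)

lemma sequential_enumeration_exists:
  assumes "countable Z"
  obtains Y where "sequential_enumeration Z Y"
proof
  \<comment> \<open>Indices that code no element of \<open>Z\<close> give empty blocks, so finite
    and infinite \<open>Z\<close> are treated alike.\<close>
  let ?Y = "\<lambda>\<tau>. {z \<in> Z. to_nat_on Z z = \<tau>}"
  have "?Y \<tau> = {} \<or> (\<exists>i. ?Y \<tau> = {i})" for \<tau>
    using inj_on_to_nat_on[OF assms] by (auto dest: inj_onD)
  then show "sequential_enumeration Z ?Y"
    by (auto simp: sequential_enumeration_def enumeration_def disjoint_family_on_def)
qed

text \<open>Coordinate \<open>i\<close> of the enumeration network is fixed once its block has been
  updated. Placing \<open>{i}\<close> first yields the right-hand side, placing it directly after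
  \<open>s\<close> yields the left-hand side; \<open>Y\<close> and \<open>Y'\<close> complete the
  enumerations.\<close>

lemma enum_network_agree_imp_eq:
  assumes "enumeration (Z - {i}) Y" "enumeration (Z - s - {i}) Y'"
    and i: "i \<in> Z" "i \<notin> s" and s: "s \<subseteq> Z" and x: "x \<in> Z \<rightarrow>\<^sub>E Q"
    and agree: "maps_eq Q Z (enum_network Z f (case_nat {i} Y))
      (enum_network Z f (case_nat s (case_nat {i} Y')))"
  shows "f (update f s x) i = f x i"
proof -
  have 1: "enumeration Z (case_nat {i} Y)"
    using assms by (intro enumeration_case_nat) auto
  have 2: "enumeration Z (case_nat s (case_nat {i} Y'))"
    using assms by (intro enumeration_case_nat) auto
  have "enum_network Z f (case_nat {i} Y) x i = f x i"
    using enum_network_block[OF 1, of i 0 f x] by (simp add: update_def)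
  moreover have "enum_network Z f (case_nat s (case_nat {i} Y')) x i = f (update f s x) i"
    using enum_network_block[OF 2, of i "Suc 0" f x] by (simp add: update_def)
  ultimately show ?thesis
    using agree x by (simp add: maps_eq_def)
qed

section \<open>The equivalences through insensitivity\<close>

lemma C1_insensitive: "C1 Q Z f \<Longrightarrow> insensitive Q Z ((\<lambda>j. {j}) ` Z) f"
  by (rule commute_imp_insensitive) (auto simp: C1_def simp del: updates_Cons)

lemma C1a_insensitive:
  assumes "C1a Q Z f" "countable Z"
  shows "insensitive Q Z ((\<lambda>j. {j}) ` Z) f"
  unfolding insensitive_def
proof (intro ballI)
  fix U i x
  assume U: "U \<in> (\<lambda>j. {j}) ` Z" and i: "i \<in> Z - U" and x: "x \<in> Z \<rightarrow>\<^sub>E Q"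
  obtain j where j: "U = {j}" "j \<in> Z" using U by auto
  obtain Y where Y: "sequential_enumeration (Z - {i}) Y"
    using sequential_enumeration_exists[of "Z - {i}"] assms(2) by auto
  obtain Y' where Y': "sequential_enumeration (Z - {j} - {i}) Y'"
    using sequential_enumeration_exists[of "Z - {j} - {i}"] assms(2) by auto
  have "sequential_enumeration Z (case_nat {i} Y)"
    "sequential_enumeration Z (case_nat {j} (case_nat {i} Y'))"
    using i j Y Y' by (auto intro!: sequential_enumeration_case_nat)
  then have "maps_eq Q Z (enum_network Z f (case_nat {i} Y))
      (enum_network Z f (case_nat {j} (case_nat {i} Y')))"
    using assms(1) by (simp add: C1a_def)
  then show "f (update f U x) i = f x i"
    using enum_network_agree_imp_eq[of Z i Y "{j}" Y' x Q f] i j x Y Y'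
    by (auto simp: sequential_enumeration_def)
qed

lemma C3a_insensitive:
  assumes "C3a Q Z f"
  shows "insensitive Q Z (Pow Z) f"
  unfolding insensitive_def
proof (intro ballI)
  fix U i x
  assume U: "U \<in> Pow Z" and i: "i \<in> Z - U" and x: "x \<in> Z \<rightarrow>\<^sub>E Q"
  have enum: "enumeration A (case_nat A (\<lambda>_. {}))" for A :: "'b set"
    by (rule enumeration_case_nat) (auto simp: enumeration_def disjoint_family_on_def)
  \<comment> \<open>Blocks may be infinite here, so all remaining coordinates form one block,
    followed by empty ones.\<close>
  let ?Y = "case_nat (Z - {i}) (\<lambda>_. {})" and ?Y' = "case_nat (Z - U - {i}) (\<lambda>_. {})"
  have "enumeration Z (case_nat {i} ?Y)" "enumeration Z (case_nat U (case_nat {i} ?Y'))"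
    using i U by (auto intro!: enumeration_case_nat enum)
  then show "f (update f U x) i = f x i"
    using enum_network_agree_imp_eq[OF enum enum, of i Z U x Q f] i U x assms
    by (simp add: C3a_def)
qed

lemma insensitive_C2:
  "insensitive Q Z {U. U \<subseteq> Z \<and> finite U} f \<Longrightarrow> is_network Q Z f \<Longrightarrow> C2 Q Z f"
  unfolding C2_def
  by (intro allI impI insensitive_imp_commute[where F = "{U. U \<subseteq> Z \<and> finite U}"])
     (auto dest: finite_subset)

lemma insensitive_C3: "insensitive Q Z (Pow Z) f \<Longrightarrow> is_network Q Z f \<Longrightarrow> C3 Q Z f"
  unfolding C3_def
  by (intro allI impI insensitive_imp_commute[where F = "Pow Z"]) auto

lemma C3_insensitive: "C3 Q Z f \<Longrightarrow> insensitive Q Z (Pow Z) f"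
  by (rule commute_imp_insensitive) (auto simp: C3_def simp del: updates_Cons)

lemma insensitive_C2b:
  assumes "insensitive Q Z {U. U \<subseteq> Z \<and> finite U} f" "is_network Q Z f"
  shows "C2b Q Z f"
  unfolding C2b_def
proof (intro allI impI)
  fix B
  assume "finite_block_enumeration Z B"
  then show "maps_eq Q Z f (enum_network Z f B)"
    by (intro insensitive_imp_enum_network[OF assms(1) _ assms(2)])
       (auto simp: finite_block_enumeration_def enumeration_def)
qed

lemma insensitive_C3b:
  assumes "insensitive Q Z (Pow Z) f" "is_network Q Z f"
  shows "C3b Q Z f"
  unfolding C3b_def
proof (intro allI impI)
  fix S
  assume "enumeration Z S"
  then show "maps_eq Q Z f (enum_network Z f S)"
    by (intro insensitive_imp_enum_network[OF assms(1) _ assms(2)]) (auto simp: enumeration_def)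
qed

lemma sequential_imp_finite_block:
  "sequential_enumeration Z Y \<Longrightarrow> finite_block_enumeration Z Y"
  unfolding sequential_enumeration_def finite_block_enumeration_def
  by (metis finite.simps)

text \<open>By insensitivity to finite sets, (C1) and (C1a) each imply both (C2) and (C2b). The way
  back restricts to singleton blocks, or uses that two networks equal to \<open>f\<close> agree. The
  properties for arbitrary blocks form a separate, similar cycle.\<close>

lemma commutativity_equivalences:
  assumes "countable Z" and net: "is_network Q Z f"
  shows "(C1 Q Z f \<longleftrightarrow> C1a Q Z f) \<and> (C1a Q Z f \<longleftrightarrow> C1b Q Z f)"
    and "(C2 Q Z f \<longleftrightarrow> C2a Q Z f) \<and> (C2a Q Z f \<longleftrightarrow> C2b Q Z f)"
    and "(C3 Q Z f \<longleftrightarrow> C3a Q Z f) \<and> (C3a Q Z f \<longleftrightarrow> C3b Q Z f)"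
    and "C1 Q Z f \<longleftrightarrow> C2 Q Z f"
proof -
  have fin: "C2 Q Z f \<and> C2b Q Z f" if "C1 Q Z f \<or> C1a Q Z f"
    using that C1_insensitive C1a_insensitive assms insensitive_finite
      insensitive_C2 insensitive_C2b by metis
  have arb: "C3 Q Z f \<and> C3b Q Z f" if "C3 Q Z f \<or> C3a Q Z f"
    using that C3_insensitive C3a_insensitive net insensitive_C3 insensitive_C3b by metis
  have "C2 Q Z f \<Longrightarrow> C1 Q Z f" by (simp add: C1_def C2_def del: updates_Cons)
  moreover have "C2b Q Z f \<Longrightarrow> C1b Q Z f"
    using sequential_imp_finite_block by (auto simp: C1b_def C2b_def)
  moreover have "C2a Q Z f \<Longrightarrow> C1a Q Z f"
    using sequential_imp_finite_block by (auto simp: C1a_def C2a_def)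
  moreover have "C1b Q Z f \<Longrightarrow> C1a Q Z f" "C2b Q Z f \<Longrightarrow> C2a Q Z f" "C3b Q Z f \<Longrightarrow> C3a Q Z f"
    unfolding C1b_def C1a_def C2b_def C2a_def C3b_def C3a_def maps_eq_def by metis+
  ultimately show "(C1 Q Z f \<longleftrightarrow> C1a Q Z f) \<and> (C1a Q Z f \<longleftrightarrow> C1b Q Z f)"
    "(C2 Q Z f \<longleftrightarrow> C2a Q Z f) \<and> (C2a Q Z f \<longleftrightarrow> C2b Q Z f)"
    "(C3 Q Z f \<longleftrightarrow> C3a Q Z f) \<and> (C3a Q Z f \<longleftrightarrow> C3b Q Z f)"
    "C1 Q Z f \<longleftrightarrow> C2 Q Z f"
    using fin arb by blast+
qed

section \<open>A network with (C1) but not (C3)\<close>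

definition tail_network :: "(nat \<Rightarrow> nat) \<Rightarrow> nat \<Rightarrow> nat" where
  "tail_network x = (\<lambda>_. if finite {k. x k = 0} then 0 else 1)"

text \<open>The zero sets before and after the update differ only inside \<open>U\<close>, so one is
  finite iff the other is.\<close>

lemma tail_network_update_finite:
  assumes "finite U"
  shows "tail_network (update tail_network U x) = tail_network x"
proof -
  have "finite {k. update tail_network U x k = 0} \<longleftrightarrow> finite {k. x k = 0}"
  proof
    assume "finite {k. update tail_network U x k = 0}"
    then show "finite {k. x k = 0}"
      using assms by (elim finite_subset[rotated, OF finite_UnI]) (auto simp: update_def)
  next
    assume "finite {k. x k = 0}"
    then show "finite {k. update tail_network U x k = 0}"
      using assms by (elim finite_subset[rotated, OF finite_UnI]) (auto simp: update_def)
  qed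
  then show ?thesis by (simp add: tail_network_def)
qed

lemma C1_not_C3:
  "is_network {0, 1} UNIV tail_network" "C1 {0, 1} UNIV tail_network"
  "\<not> C3 {0, 1} UNIV tail_network"
proof -
  show net: "is_network {0, 1} UNIV tail_network"
    by (auto simp: is_network_def tail_network_def)
  have "insensitive {0, 1} UNIV {U. U \<subseteq> UNIV \<and> finite U} tail_network"
    by (simp add: insensitive_def tail_network_update_finite)
  then show "C1 {0, 1} UNIV tail_network"
    using insensitive_C2[OF _ net] commutativity_equivalences(4)[OF _ net] by simp
  show "\<not> C3 {0, 1} UNIV tail_network"
  proof
    assume "C3 {0, 1} UNIV tail_network"
    then have "insensitive {0, 1} UNIV (Pow UNIV) tail_network"
      by (rule C3_insensitive)
    \<comment> \<open>The zero configuration is mapped to constant 1, so updating all coordinates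
      but 0 leaves a single zero and flips the value of the network. The values 0 and 1 in
      \<open>tail_network\<close> are chosen for this flip: exchanged, no update could change the
      value.\<close>
    then have "tail_network (update tail_network (- {0}) (\<lambda>_. 0)) 0 = tail_network (\<lambda>_. 0) 0"
      by (rule insensitiveD) (simp_all add: PiE_UNIV_domain)
    moreover have "tail_network (\<lambda>_. 0) = (\<lambda>_. 1)"
      by (simp add: tail_network_def)
    moreover from this have "{k. update tail_network (- {0}) (\<lambda>_. 0) k = 0} = {0}"
      by (auto simp: update_def)
    ultimately show False
      by (simp add: tail_network_def)
  qed
qed

theorem theorem1:
  "(\<forall>(Q :: 'q set) (Z :: 'z set) f.
      finite Q \<and> card Q \<ge> 2 \<and> countable Z \<and> is_network Q Z f \<longrightarrow>
        ((C1 Q Z f \<longleftrightarrow> C1a Q Z f) \<and> (C1a Q Z f \<longleftrightarrow> C1b Q Z f)) \<and>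
        ((C2 Q Z f \<longleftrightarrow> C2a Q Z f) \<and> (C2a Q Z f \<longleftrightarrow> C2b Q Z f)) \<and>
        ((C3 Q Z f \<longleftrightarrow> C3a Q Z f) \<and> (C3a Q Z f \<longleftrightarrow> C3b Q Z f)) \<and>
        (C1 Q Z f \<longleftrightarrow> C2 Q Z f)) \<and>
   (\<exists>(Q :: nat set) (Z :: nat set) f.
      finite Q \<and> card Q \<ge> 2 \<and> countable Z \<and> is_network Q Z f \<and> C1 Q Z f \<and> \<not> C3 Q Z f)"
proof (rule conjI, intro allI impI)
  fix Q :: "'q set" and Z :: "'z set" and f
  assume "finite Q \<and> card Q \<ge> 2 \<and> countable Z \<and> is_network Q Z f"
  then show "((C1 Q Z f \<longleftrightarrow> C1a Q Z f) \<and> (C1a Q Z f \<longleftrightarrow> C1b Q Z f)) \<and>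
        ((C2 Q Z f \<longleftrightarrow> C2a Q Z f) \<and> (C2a Q Z f \<longleftrightarrow> C2b Q Z f)) \<and>
        ((C3 Q Z f \<longleftrightarrow> C3a Q Z f) \<and> (C3a Q Z f \<longleftrightarrow> C3b Q Z f)) \<and>
        (C1 Q Z f \<longleftrightarrow> C2 Q Z f)"
    using commutativity_equivalences[of Z Q f] by simp
next
  show "\<exists>(Q :: nat set) (Z :: nat set) f.
      finite Q \<and> card Q \<ge> 2 \<and> countable Z \<and> is_network Q Z f \<and> C1 Q Z f \<and> \<not> C3 Q Z f"
    using C1_not_C3 by (intro exI[of _ "{0, 1}"] exI[of _ UNIV] exI[of _ tail_network]) simp
qed

end
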